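(* Let $b\in\mathscr{S}(n)$. Let $\alpha:\mathbb{R}\to\mathcal{U}(n)$ be a $C^1$ function such that for all $t\in\mathbb{R}$ the (Hermitian) matrix $i\alpha'(t)\alpha(t)^{-1}$ is sign definite (i.e. positive definite or negative definite). Then, given any singular (with respect to Lebesgue measure) Radon measure $\nu$ on $\mathbb{T}$, the scalar measures $\mu^{\alpha(t)}:=\operatorname{tr}\boldsymbol{\mu}^{\alpha(t)}$ are mutually singular with $\nu$ for all $t\in\mathbb{R}$ except at most countably many.
   Context: $\mathbb{D}$ is the open unit disc and $\mathbb{T}=\partial\mathbb{D}$. $\mathscr{S}(n)$ is the set of bounded analytic $n\times n$ matrix-valued functions $b$ on $\mathbb{D}$ with $\|b(z)\|<1$ (operator norm) for all $z\in\mathbb{D}$. $\mathcal{U}(n)$ is the group of unitary $n\times n$ matrices. For $b\in\mathscr{S}(n)$ and $\alpha\in\mathcal{U}(n)$, the Aleksandrov--Clark measure $\boldsymbol{\mu}^\alpha$ is the unique finite non-negative $\mathbb{C}^{n\times n}$-valued Borel measure on $\mathbb{T}$ such that, with $H_\alpha(z)=(I_n+b(z)\alpha^* )(I_n-b(z)\alpha^* )^{-1}$, $$H_\alpha(z)=i\,\mathrm{Im}\,H_\alpha(0)+\int_{\mathbb{T}}\frac{\zeta+z}{\zeta-z}\,\boldsymbol{\mu}^\alpha(\mathrm{d}\zeta),\qquad z\in\mathbb{D},$$ where $\mathrm{Im}\,A=(A-A^* )/(2i)$. *)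

theory Defs
  imports "HOL-Analysis.Analysis"
begin

section \<open>Complex matrices\<close>

definition adj :: "complex^'n^'n \<Rightarrow> complex^'n^'n" where
  "adj A = map_matrix cnj (transpose A)"

definition cscale :: "complex \<Rightarrow> complex^'n^'n \<Rightarrow> complex^'n^'n" where
  "cscale c A = map_matrix ((*) c) A"

definition Im_matrix :: "complex^'n^'n \<Rightarrow> complex^'n^'n" where
  "Im_matrix A = cscale (1 / (2 * \<i>)) (A - adj A)"

definition unitary :: "complex^'n^'n \<Rightarrow> bool" where
  "unitary U \<longleftrightarrow> adj U ** U = mat 1 \<and> U ** adj U = mat 1"

definition quad_form :: "complex^'n^'n \<Rightarrow> complex^'n \<Rightarrow> complex" where
  "quad_form A v = (\<Sum>i\<in>UNIV. cnj (v $ i) * (A *v v) $ i)"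

text \<open>For Hermitian A the quadratic form is real valued, so taking real parts loses nothing.\<close>

definition pos_semidefinite :: "complex^'n^'n \<Rightarrow> bool" where
  "pos_semidefinite A \<longleftrightarrow> adj A = A \<and> (\<forall>v. 0 \<le> Re (quad_form A v))"

definition pos_definite :: "complex^'n^'n \<Rightarrow> bool" where
  "pos_definite A \<longleftrightarrow> adj A = A \<and> (\<forall>v. v \<noteq> 0 \<longrightarrow> 0 < Re (quad_form A v))"

definition neg_definite :: "complex^'n^'n \<Rightarrow> bool" where
  "neg_definite A \<longleftrightarrow> adj A = A \<and> (\<forall>v. v \<noteq> 0 \<longrightarrow> Re (quad_form A v) < 0)"

definition sign_definite :: "complex^'n^'n \<Rightarrow> bool" where
  "sign_definite A \<longleftrightarrow> pos_definite A \<or> neg_definite A"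

definition op_norm :: "complex^'n^'n \<Rightarrow> real" where
  "op_norm A = onorm (\<lambda>v. A *v v)"

definition schur_class :: "(complex \<Rightarrow> complex^'n^'n) set" where
  "schur_class = {b. (\<forall>i j. (\<lambda>z. b z $ i $ j) holomorphic_on ball 0 1) \<and>
     bounded (b ` ball 0 1) \<and> (\<forall>z\<in>ball 0 1. op_norm (b z) < 1)}"

section \<open>Scalar measures on the unit circle\<close>

definition circle_borel :: "complex measure" where
  "circle_borel = restrict_space borel (sphere 0 1)"

text \<open>Arc length, of total mass \<open>2 * pi\<close>; only its null sets matter.\<close>

definition circle_lebesgue :: "complex measure" where
  "circle_lebesgue = distr (restrict_space lborel {0..<2 * pi}) circle_borel cis"

definition circle_radon_measure :: "complex measure \<Rightarrow> bool" where
  "circle_radon_measure \<nu> \<longleftrightarrow> sets \<nu> = sets circle_borel \<and>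
     (\<forall>K. compact K \<and> K \<subseteq> sphere 0 1 \<longrightarrow> emeasure \<nu> K < \<infinity>) \<and>
     (\<forall>A\<in>sets \<nu>. emeasure \<nu> A = (SUP K\<in>{K. compact K \<and> K \<subseteq> A}. emeasure \<nu> K))"

definition mutually_singular :: "'a measure \<Rightarrow> 'a measure \<Rightarrow> bool" where
  "mutually_singular M N \<longleftrightarrow> sets M = sets N \<and>
     (\<exists>A\<in>sets M. emeasure M A = 0 \<and> emeasure N (space N - A) = 0)"

section \<open>Integration against complex and matrix-valued measures\<close>

text \<open>
  Complex and matrix-valued measures on the circle are represented by set functions, of which only
  the values on Borel subsets of the circle are relevant. A finite signed measure has the Jordan
  decomposition into \<open>pos_variation l\<close> and \<open>pos_variation (- l)\<close>; the supremum below ranges over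
  truncated values, but the empty set is always admitted, so the truncation has no effect.
\<close>

definition pos_variation :: "(complex set \<Rightarrow> real) \<Rightarrow> complex measure" where
  "pos_variation l = measure_of (sphere 0 1) (sets circle_borel)
     (\<lambda>A. SUP B\<in>{B \<in> sets circle_borel. B \<subseteq> A}. ennreal (l B))"

definition signed_integral :: "(complex set \<Rightarrow> real) \<Rightarrow> (complex \<Rightarrow> complex) \<Rightarrow> complex" where
  "signed_integral l f =
     integral\<^sup>L (pos_variation l) f - integral\<^sup>L (pos_variation (\<lambda>A. - l A)) f"

definition complex_measure_integral ::
    "(complex set \<Rightarrow> complex) \<Rightarrow> (complex \<Rightarrow> complex) \<Rightarrow> complex" where
  "complex_measure_integral l f =
     signed_integral (\<lambda>A. Re (l A)) f + \<i> * signed_integral (\<lambda>A. Im (l A)) f"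

definition matrix_measure :: "(complex set \<Rightarrow> complex^'n^'n) \<Rightarrow> bool" where
  "matrix_measure \<mu> \<longleftrightarrow>
     (\<forall>A\<in>sets circle_borel. pos_semidefinite (\<mu> A)) \<and>
     (\<forall>A::nat \<Rightarrow> complex set. range A \<subseteq> sets circle_borel \<longrightarrow> disjoint_family A \<longrightarrow>
        (\<lambda>k. \<mu> (A k)) sums \<mu> (\<Union>k. A k))"

definition matrix_integral ::
    "(complex set \<Rightarrow> complex^'n^'n) \<Rightarrow> (complex \<Rightarrow> complex) \<Rightarrow> complex^'n^'n" where
  "matrix_integral \<mu> f = (\<chi> i j. complex_measure_integral (\<lambda>A. \<mu> A $ i $ j) f)"

definition trace_measure :: "(complex set \<Rightarrow> complex^'n^'n) \<Rightarrow> complex measure" where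
  "trace_measure \<mu> =
     measure_of (sphere 0 1) (sets circle_borel) (\<lambda>A. ennreal (Re (trace (\<mu> A))))"

section \<open>Aleksandrov--Clark measures\<close>

definition clark_transform ::
    "(complex \<Rightarrow> complex^'n^'n) \<Rightarrow> complex^'n^'n \<Rightarrow> complex \<Rightarrow> complex^'n^'n" where
  "clark_transform b \<alpha> z =
     (mat 1 + b z ** adj \<alpha>) ** matrix_inv (mat 1 - b z ** adj \<alpha>)"

text \<open>
  \<open>clark_measure b \<alpha> \<mu>\<close> says that \<open>\<mu>\<close> is the Aleksandrov--Clark measure of \<open>b\<close> at \<open>\<alpha>\<close>, by its
  defining Herglotz representation, which determines the measure uniquely on Borel sets.
\<close>

definition clark_measure ::
    "(complex \<Rightarrow> complex^'n^'n) \<Rightarrow> complex^'n^'n \<Rightarrow> (complex set \<Rightarrow> complex^'n^'n) \<Rightarrow> bool" where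
  "clark_measure b \<alpha> \<mu> \<longleftrightarrow> matrix_measure \<mu> \<and>
     (\<forall>z\<in>ball 0 1. clark_transform b \<alpha> z =
        cscale \<i> (Im_matrix (clark_transform b \<alpha> 0)) +
        matrix_integral \<mu> (\<lambda>\<zeta>. (\<zeta> + z) / (\<zeta> - z)))"

end

theory Submission
  imports Defs
begin

text \<open>
  Let \<open>m\<close> be arc length and \<open>N\<close> an \<open>m\<close>-null set carrying \<open>\<nu>\<close>. A finite measure on the circle has
  infinite density with respect to \<open>m\<close> at almost all of its own points in \<open>N\<close>, and the Poisson
  integral of the trace measure of \<open>\<alpha>\<close> is \<open>Re (tr H\<^sub>\<alpha>)\<close>. Hence for almost all points \<open>x\<close> of \<open>N\<close> with
  respect to this measure \<open>Re (tr H\<^sub>\<alpha>)\<close> tends to infinity along the radius at \<open>x\<close>, which forces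
  \<open>det (1 - b \<alpha>\<^sup>*)\<close> to tend to \<open>0\<close> there. Call the set of such points the resonance set of \<open>\<alpha>\<close>: if the
  trace measure is not singular to \<open>\<nu>\<close>, the resonance set has positive \<open>\<nu>\<close>-measure.

  A point \<open>x\<close> lies in the resonance sets of \<open>\<alpha>(t)\<close> for only finitely many \<open>t\<close> in a bounded set. No
  boundary value of \<open>b\<close> at \<open>x\<close> is needed: a radial cluster point \<open>B\<close>, which is a contraction, satisfies
  \<open>det (1 - B \<alpha>(t)\<^sup>*) = 0\<close> for all these \<open>t\<close>, and by definiteness the solutions of this equation do not
  accumulate. Since \<open>\<nu>\<close> is finite, only countably many resonance sets have positive measure.
\<close>

section \<open>Contractions meeting a path of unitary matrices\<close>

lemma inner_complex_vec: "inner x (y::complex^'n) = Re (\<Sum>i\<in>UNIV. cnj (x $ i) * y $ i)"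
  by (simp add: inner_vec_def inner_complex_def)

lemma adj_inner:
  fixes A :: "complex^'n^'n"
  shows "inner (A *v x) y = inner x (adj A *v y)"
proof -
  have "(\<Sum>i\<in>UNIV. cnj ((A *v x) $ i) * y $ i)
      = (\<Sum>i\<in>UNIV. \<Sum>j\<in>UNIV. cnj (A $ i $ j) * cnj (x $ j) * y $ i)"
    by (simp add: matrix_vector_mult_def sum_distrib_right)
  also have "\<dots> = (\<Sum>j\<in>UNIV. \<Sum>i\<in>UNIV. cnj (A $ i $ j) * cnj (x $ j) * y $ i)"
    by (rule sum.swap)
  also have "\<dots> = (\<Sum>i\<in>UNIV. cnj (x $ i) * (adj A *v y) $ i)"
    by (simp add: matrix_vector_mult_def adj_def transpose_def map_matrix_def sum_distrib_left mult_ac)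
  finally show ?thesis by (simp add: inner_complex_vec)
qed

lemma unitary_norm:
  fixes U :: "complex^'n^'n"
  assumes "unitary U"
  shows "norm (U *v x) = norm x"
proof -
  have "inner (U *v x) (U *v x) = inner x x"
    using assms by (simp add: adj_inner matrix_vector_mul_assoc unitary_def)
  then show ?thesis by (simp add: norm_eq_sqrt_inner)
qed

lemma unitary_adj: "unitary U \<Longrightarrow> unitary (adj U)"
  by (simp add: unitary_def adj_def transpose_def map_matrix_def)

text \<open>This is the equality case of Cauchy-Schwarz. The adjoint of a contraction is again a
  contraction, so w = B* B v has norm at most |v|. Since <v, w> = |B v|^2 = |v|^2, expanding |w -
  v|^2 gives at most 0.\<close>

lemma adj_mult_eq_of_norm_le:
  fixes B :: "complex^'n^'n"
  assumes B: "\<And>v. norm (B *v v) \<le> norm v"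
    and that: "norm (B *v v) = norm v"
  shows "adj B *v (B *v v) = v"
proof -
  have le: "norm (adj B *v y) \<le> norm y" for y
  proof -
    have "(norm (adj B *v y))\<^sup>2 = inner (B *v (adj B *v y)) y"
      by (simp add: adj_inner power2_norm_eq_inner)
    also have "\<dots> \<le> norm (B *v (adj B *v y)) * norm y"
      by (rule norm_cauchy_schwarz)
    also have "\<dots> \<le> norm (adj B *v y) * norm y"
      by (simp add: B mult_right_mono)
    finally show ?thesis
      by (cases "adj B *v y = 0") (auto simp: power2_eq_square)
  qed
  let ?w = "adj B *v (B *v v)"
  have "inner v ?w = (norm v)\<^sup>2"
    using that by (simp add: power2_norm_eq_inner flip: adj_inner) (simp flip: power2_norm_eq_inner)
  moreover have "norm ?w \<le> norm v"
    using le[of "B *v v"] that by simp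
  ultimately have "(norm (?w - v))\<^sup>2 \<le> 0"
    using power_mono[of "norm ?w" "norm v" 2]
    by (simp add: power2_norm_eq_inner inner_diff_left inner_diff_right inner_commute)
  then show ?thesis by simp
qed

lemma Re_quad_form: "Re (quad_form A v) = inner v (A *v v)"
  by (simp add: quad_form_def inner_vec_def inner_complex_def)

lemma cscale_mult_vec: "cscale c A *v x = c *s (A *v x)"
  by (simp add: cscale_def map_matrix_def matrix_vector_mult_def vec_eq_iff sum_distrib_left mult.assoc)

lemma matrix_mul_matrix_inv:
  assumes "invertible A"
  shows "A ** matrix_inv A = mat 1"
  using someI_ex[OF assms[unfolded invertible_def]] by (simp add: matrix_inv_def)

lemma matrix_inv_unitary:
  assumes "unitary U"
  shows "matrix_inv U = adj U"
proof -
  have "invertible U" using assms by (auto simp: unitary_def invertible_def)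
  then have "adj U ** (U ** matrix_inv U) = adj U" by (simp add: matrix_mul_matrix_inv)
  then show ?thesis
    using assms by (simp add: matrix_mul_assoc unitary_def)
qed

lemma bounded_bilinear_matrix_vector:
  "bounded_bilinear (\<lambda>(A::complex^'n^'m) x. A *v x)"
proof -
  have "bilinear (\<lambda>(A::complex^'n^'m) x. A *v x)"
    by (auto simp: bilinear_def linear_iff matrix_vector_mult_def vec_eq_iff algebra_simps
        sum.distrib scaleR_right.sum)
  then show ?thesis by (simp add: bilinear_conv_bounded_bilinear)
qed

lemma has_vector_derivative_tendsto:
  assumes "(f has_vector_derivative D) (at a)"
  shows "((\<lambda>t. (f t - f a) /\<^sub>R (t - a)) \<longlongrightarrow> D) (at a)"
proof -
  have "((\<lambda>t. norm ((f t - f a - (t - a) *\<^sub>R D) /\<^sub>R norm (t - a))) \<longlongrightarrow> 0) (at a)"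
    using assms by (intro tendsto_norm_zero) (simp add: has_vector_derivative_def has_derivative_at_within)
  then have "((\<lambda>t. norm ((f t - f a) /\<^sub>R (t - a) - D)) \<longlongrightarrow> 0) (at a)"
  proof (rule Lim_transform_within[OF _ zero_less_one])
    fix t assume "0 < dist t a"
    then have "(f t - f a) /\<^sub>R (t - a) - D = (f t - f a - (t - a) *\<^sub>R D) /\<^sub>R (t - a)"
      by (simp add: scaleR_diff_right)
    then show "norm ((f t - f a - (t - a) *\<^sub>R D) /\<^sub>R norm (t - a)) = norm ((f t - f a) /\<^sub>R (t - a) - D)"
      by simp
  qed
  then show ?thesis
    by (subst Lim_null) (rule tendsto_norm_zero_cancel)
qed

text \<open>Since \<open>B\<close> is a contraction and \<open>B w = \<alpha>(t\<^sub>0) w\<close>, the adjoint of \<open>B\<close> maps \<open>\<alpha>(t\<^sub>0) w\<close> back to \<open>w\<close>.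
  Pairing \<open>\<alpha>(t\<^sub>k) v\<^sub>k = B v\<^sub>k\<close> with \<open>\<alpha>(t\<^sub>0) w\<close> therefore gives
  \<open>\<langle>(\<alpha>(t\<^sub>k) - \<alpha>(t\<^sub>0)) v\<^sub>k, \<alpha>(t\<^sub>0) w\<rangle> = 0\<close>. The real inner product sees only the real part of this, which
  carries no information in the limit; the factor \<open>\<i>\<close> in \<open>y\<close> selects the imaginary part.\<close>

lemma resonance_not_accumulating:
  fixes \<alpha> :: "real \<Rightarrow> complex^'n^'n" and B D :: "complex^'n^'n"
  assumes B: "\<And>v. norm (B *v v) \<le> norm v"
    and U: "\<And>t. unitary (\<alpha> t)"
    and D: "(\<alpha> has_vector_derivative D) (at t0)"
    and sd: "sign_definite (cscale \<i> (D ** matrix_inv (\<alpha> t0)))"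
    and t: "t \<longlonglongrightarrow> t0" "\<And>k. t k \<noteq> t0"
    and v: "v \<longlonglongrightarrow> w" "\<And>k. norm (v k) = 1" "\<And>k. \<alpha> (t k) *v v k = B *v v k"
  shows False
proof -
  have lim: "filterlim t (at t0) sequentially"
    using t by (simp add: filterlim_at)
  have \<alpha>0: "isCont \<alpha> t0"
    using D has_vector_derivative_continuous by blast
  then have "(\<lambda>k. \<alpha> (t k)) \<longlonglongrightarrow> \<alpha> t0"
    using t(1) isCont_tendsto_compose by blast
  then have "(\<lambda>k. \<alpha> (t k) *v v k) \<longlonglongrightarrow> \<alpha> t0 *v w"
    using bounded_bilinear.tendsto[OF bounded_bilinear_matrix_vector] v(1) by blast
  moreover have "(\<lambda>k. B *v v k) \<longlonglongrightarrow> B *v w"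
    using bounded_bilinear.tendsto[OF bounded_bilinear_matrix_vector] v(1) tendsto_const by blast
  ultimately have Bw: "\<alpha> t0 *v w = B *v w"
    using v(3) LIMSEQ_unique by simp
  have nw: "norm w = 1"
    using tendsto_norm[OF v(1)] v(2) LIMSEQ_unique[of "\<lambda>_. 1::real"] by fastforce
  have adjB: "adj B *v (\<alpha> t0 *v w) = w"
    using adj_mult_eq_of_norm_le[of B w, OF B] unitary_norm[OF U] Bw by metis
  have adj\<alpha>: "adj (\<alpha> t0) *v (\<alpha> t0 *v w) = w"
    using U[of t0] by (simp add: matrix_vector_mul_assoc unitary_def)
  define y where "y = \<i> *s (\<alpha> t0 *v w)"
  have "inner ((\<alpha> (t k) - \<alpha> t0) *v v k) y = 0" for k
  proof -
    have "inner ((\<alpha> (t k) - \<alpha> t0) *v v k) y = inner (B *v v k) y - inner (\<alpha> t0 *v v k) y"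
      by (simp add: matrix_vector_mult_diff_rdistrib v(3) inner_diff_left)
    then show ?thesis
      by (simp add: adj_inner y_def vec.scale adjB adj\<alpha>)
  qed
  then have "inner (((\<alpha> (t k) - \<alpha> t0) /\<^sub>R (t k - t0)) *v v k) y = 0" for k
    by (simp add: bounded_bilinear.scaleR_left[OF bounded_bilinear_matrix_vector])
  moreover have "(\<lambda>k. (\<alpha> (t k) - \<alpha> t0) /\<^sub>R (t k - t0)) \<longlonglongrightarrow> D"
    by (rule filterlim_compose[OF has_vector_derivative_tendsto[OF D] lim])
  then have "(\<lambda>k. inner (((\<alpha> (t k) - \<alpha> t0) /\<^sub>R (t k - t0)) *v v k) y) \<longlonglongrightarrow> inner (D *v w) y"
    using bounded_bilinear.tendsto[OF bounded_bilinear_matrix_vector] v(1) 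
    by (intro tendsto_inner tendsto_const) blast
  ultimately have 0: "inner (D *v w) y = 0"
    by (simp add: LIMSEQ_const_iff)
  \<comment> \<open>Testing the definite matrix on u cancels the inverse of \<alpha>(t0) and leaves
    i D w, so its quadratic form is, up to sign, the pairing just shown to vanish.\<close>
  define u where "u = \<alpha> t0 *v w"
  have u0: "u \<noteq> 0" using unitary_norm[OF U, of t0 w] nw by (auto simp: u_def)
  have "cscale \<i> (D ** matrix_inv (\<alpha> t0)) *v u = \<i> *s (D *v w)"
    using adj\<alpha> by (simp add: cscale_mult_vec matrix_inv_unitary[OF U] u_def flip: matrix_vector_mul_assoc)
  then have "Re (quad_form (cscale \<i> (D ** matrix_inv (\<alpha> t0))) u) = inner u (\<i> *s (D *v w))"
    by (simp add: Re_quad_form)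
  also have "\<dots> = - inner (D *v w) y"
    by (simp add: y_def u_def inner_vec_def inner_complex_def sum_negf[symmetric] algebra_simps)
  finally have "Re (quad_form (cscale \<i> (D ** matrix_inv (\<alpha> t0))) u) = 0" by (simp add: 0)
  with sd u0 show False
    unfolding sign_definite_def pos_definite_def neg_definite_def by (metis less_irrefl)
qed

text \<open>An infinite bounded set of times would accumulate at some t0. Each vanishing determinant
  supplies a unit vector on which \<alpha>(t) and B agree, and compactness of the unit sphere makes
  these vectors converge along a subsequence, which \<open>resonance_not_accumulating\<close>
  excludes.\<close>

lemma finite_resonance:
  fixes \<alpha> :: "real \<Rightarrow> complex^'n^'n" and B :: "complex^'n^'n"
  assumes B: "\<And>v. norm (B *v v) \<le> norm v"
    and U: "\<And>t. unitary (\<alpha> t)"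
    and D: "\<And>t. (\<alpha> has_vector_derivative \<alpha>' t) (at t)"
    and sd: "\<And>t. sign_definite (cscale \<i> (\<alpha>' t ** matrix_inv (\<alpha> t)))"
    and "bounded T"
    and T: "\<And>t. t \<in> T \<Longrightarrow> det (mat 1 - B ** adj (\<alpha> t)) = 0"
  shows "finite T"
proof (rule ccontr)
  assume "infinite T"
  then obtain t0 where "t0 islimpt T"
    using \<open>bounded T\<close> bounded_infinite_imp_islimpt by blast
  then obtain t where t: "\<And>k. t k \<in> T - {t0}" "t \<longlonglongrightarrow> t0"
    by (auto simp: islimpt_sequential)
  have "\<exists>v. norm v = 1 \<and> \<alpha> s *v v = B *v v" if s: "s \<in> T" for s
  proof -
    have "\<exists>x. x \<noteq> 0 \<and> (mat 1 - B ** adj (\<alpha> s)) *v x = 0"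
      using T[OF s] by (metis invertible_det_nz invertible_left_inverse matrix_left_invertible_ker)
    then obtain x where x: "x \<noteq> 0" "x = B *v (adj (\<alpha> s) *v x)"
      by (auto simp: matrix_vector_mult_diff_rdistrib matrix_vector_mul_assoc)
    \<comment> \<open>Substituting x = \<alpha>(s) y turns a fixed vector of B \<alpha>(s)* into a
      solution of \<alpha>(s) y = B y; y is normalised afterwards.\<close>
    define y where "y = adj (\<alpha> s) *v x"
    have xy: "x = \<alpha> s *v y"
      using U[of s] by (simp add: y_def matrix_vector_mul_assoc unitary_def)
    have "y \<noteq> 0" using xy x(1) by auto
    moreover have "\<alpha> s *v (y /\<^sub>R norm y) = B *v (y /\<^sub>R norm y)"
      using x(2) xy unfolding y_def[symmetric] by (simp add: bounded_bilinear.scaleR_right[OF bounded_bilinear_matrix_vector])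
    ultimately show ?thesis by (intro exI[of _ "y /\<^sub>R norm y"]) simp
  qed
  then have "\<forall>k. \<exists>v. norm v = 1 \<and> \<alpha> (t k) *v v = B *v v"
    using t(1) by blast
  then obtain v where v: "\<And>k. norm (v k) = 1" "\<And>k. \<alpha> (t k) *v v k = B *v v k"
    by metis
  obtain w r where r: "strict_mono r" "(v \<circ> r) \<longlonglongrightarrow> w"
    using compact_sphere[of "0::complex^'n" 1, unfolded compact_def] v(1) by (metis mem_sphere_0)
  show False
    using resonance_not_accumulating[OF B U D sd, of "t \<circ> r" t0 "v \<circ> r" w] t v r
    by (auto simp: LIMSEQ_subseq_LIMSEQ)
qed

section \<open>Density of measures on the circle\<close>

lemma space_circle_borel [simp]: "space circle_borel = sphere 0 1"
  by (simp add: circle_borel_def space_restrict_space)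

lemma sets_circle_borel: "A \<in> sets circle_borel \<longleftrightarrow> A \<in> sets borel \<and> A \<subseteq> sphere 0 1"
  by (auto simp: circle_borel_def sets_restrict_space_iff)

lemma sets_circle_lebesgue [simp]: "sets circle_lebesgue = sets circle_borel"
  by (simp add: circle_lebesgue_def)

lemma space_circle_measure:
  assumes "sets M = sets circle_borel"
  shows "space M = sphere 0 1"
  using sets_eq_imp_space_eq[OF assms] by simp

lemma cis_measurable [measurable]: "cis \<in> restrict_space lborel {0..<2 * pi} \<rightarrow>\<^sub>M circle_borel"
proof -
  have "cis \<in> borel_measurable borel"
    by (intro borel_measurable_continuous_onI continuous_intros)
  then have "cis \<in> restrict_space lborel {0..<2 * pi} \<rightarrow>\<^sub>M borel"
    by (simp add: measurable_restrict_space1)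
  then show ?thesis
    unfolding circle_borel_def by (intro measurable_restrict_space2) auto
qed

lemma emeasure_circle_lebesgue:
  assumes "A \<in> sets circle_borel"
  shows "emeasure circle_lebesgue A = emeasure lborel (cis -` A \<inter> {0..<2 * pi})"
  using assms
  by (simp add: circle_lebesgue_def emeasure_distr emeasure_restrict_space space_restrict_space)

lemma finite_measure_circle_lebesgue: "finite_measure circle_lebesgue"
proof
  have "emeasure lborel (cis -` sphere 0 1 \<inter> {0..<2 * pi}) \<le> emeasure lborel {0..<2 * pi}"
    by (intro emeasure_mono) auto
  then have "emeasure circle_lebesgue (space circle_lebesgue) \<le> emeasure lborel {0..<2 * pi}"
    by (simp add: emeasure_circle_lebesgue space_circle_measure sets_circle_borel)
  then show "emeasure circle_lebesgue (space circle_lebesgue) \<noteq> \<infinity>"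
    by (auto simp: top_unique)
qed

lemma norm_cis_diff_le: "norm (cis s - cis t) \<le> \<bar>s - t\<bar>"
proof -
  have "cis s - cis t = cis t * (cis (s - t) - 1)"
    by (simp add: algebra_simps cis_mult)
  then have "norm (cis s - cis t) = norm (cis (s - t) - 1)"
    by (simp add: norm_mult)
  also have "\<dots> = 2 * \<bar>sin ((s - t) / 2)\<bar>"
    by (simp only: cis_conv_exp dist_exp_i_1)
  also have "\<dots> \<le> \<bar>s - t\<bar>"
    using abs_sin_x_le_abs_x[of "(s - t) / 2"] by simp
  finally show ?thesis .
qed

text \<open>Because \<open>cis\<close> is 1-Lipschitz, all angles within s of that of x land in the
  ball. Only half of this interval is used, hence s and not 2 s: one half always avoids the cut at
  angle 0.\<close>

lemma emeasure_circle_lebesgue_ball: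
  assumes x: "x \<in> sphere 0 1" and s: "0 < s" "s \<le> 1"
  shows "ennreal s \<le> emeasure circle_lebesgue (ball x s \<inter> sphere 0 1)"
proof -
  define \<theta> where "\<theta> = Arg2pi x"
  have \<theta>: "0 \<le> \<theta>" "\<theta> < 2 * pi" "x = cis \<theta>"
    using Arg2pi[of x] complex_norm_eq_1_exp[of x] x by (auto simp: \<theta>_def cis_conv_exp)
  have near: "cis \<phi> \<in> ball x s \<inter> sphere 0 1" if "\<bar>\<phi> - \<theta>\<bar> < s" for \<phi>
    using norm_cis_diff_le[of \<theta> \<phi>] that by (simp add: \<theta>(3) dist_norm abs_minus_commute)
  \<comment> \<open>The half above \<theta> is taken if it ends by 2 pi. Otherwise \<theta> > 2 pi -
    s, and the half below starts at a positive angle because s <= 1 < pi.\<close>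
  have "\<exists>a. {a<..<a + s} \<subseteq> cis -` (ball x s \<inter> sphere 0 1) \<inter> {0..<2 * pi}"
  proof (cases "\<theta> + s \<le> 2 * pi")
    case True
    with near \<theta> show ?thesis by (intro exI[of _ \<theta>]) (auto simp: subset_iff)
  next
    case False
    with near \<theta> s pi_gt3 show ?thesis by (intro exI[of _ "\<theta> - s"]) (auto simp: subset_iff)
  qed
  then obtain a where a: "{a<..<a + s} \<subseteq> cis -` (ball x s \<inter> sphere 0 1) \<inter> {0..<2 * pi}" ..
  have meas: "ball x s \<inter> sphere 0 1 \<in> sets circle_borel"
    by (simp add: sets_circle_borel)
  have "ennreal s = emeasure lborel {a<..<a + s}"
    using s by simp
  also have "\<dots> \<le> emeasure lborel (cis -` (ball x s \<inter> sphere 0 1) \<inter> {0..<2 * pi})"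
    using a measurable_sets[OF cis_measurable meas]
    by (intro emeasure_mono) (auto simp: sets_restrict_space_iff space_restrict_space)
  finally show ?thesis
    by (simp add: emeasure_circle_lebesgue meas)
qed

text \<open>Outer regularity is applied to the image of arc length on the Borel sets of the whole
  plane, so that V is open in the plane and contains genuine discs.\<close>

lemma circle_lebesgue_outer_regular:
  assumes N: "N \<in> sets circle_borel" "emeasure circle_lebesgue N = 0" and "0 < (e::ennreal)"
  obtains V where "open V" "N \<subseteq> V" "emeasure circle_lebesgue (V \<inter> sphere 0 1) < e"
proof -
  have id: "(\<lambda>x. x) \<in> circle_lebesgue \<rightarrow>\<^sub>M borel"
    by (subst measurable_cong_sets[OF sets_circle_lebesgue refl])
      (simp add: circle_borel_def measurable_restrict_space1)
  define M where "M = distr circle_lebesgue borel (\<lambda>x. x)"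
  have M: "emeasure M A = emeasure circle_lebesgue (A \<inter> sphere 0 1)" if "A \<in> sets borel" for A
    using id that by (simp add: M_def emeasure_distr space_circle_measure)
  interpret finite_measure M
    unfolding M_def by (rule finite_measure.finite_measure_distr[OF finite_measure_circle_lebesgue id])
  have "N \<inter> sphere 0 1 = N" "N \<in> sets borel" using N(1) by (auto simp: sets_circle_borel)
  then have "(INF U \<in> {U. N \<subseteq> U \<and> open U}. emeasure M U) = 0"
    using outer_regular[of M N] M[of N] N(2) emeasure_finite[of "space M"] by (simp add: M_def)
  then have "(INF U \<in> {U. N \<subseteq> U \<and> open U}. emeasure M U) < e"
    using \<open>0 < e\<close> by simp
  then obtain U where "N \<subseteq> U" "open U" "emeasure M U < e"
    unfolding INF_less_iff by auto
  with M[of U] that show thesis by simp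
qed

text \<open>Countable subadditivity, with the sum written as an integral over counting measure so
  that the centres from the Vitali lemma can serve as indices without enumeration. The indicator of
  the union is at most the sum of the indicators, and the two integrals are exchanged.\<close>

lemma emeasure_UN_le_nn_integral:
  assumes X [measurable]: "\<And>i. i \<in> I \<Longrightarrow> X i \<in> sets M" and I: "countable I"
  shows "emeasure M (\<Union>i\<in>I. X i) \<le> (\<integral>\<^sup>+i. emeasure M (X i) \<partial>count_space I)"
proof -
  have le: "indicator (\<Union>i\<in>I. X i) x \<le> (\<integral>\<^sup>+i. indicator (X i) x \<partial>count_space I)" for x
  proof (cases "x \<in> (\<Union>i\<in>I. X i)")
    case True
    then obtain j where j: "j \<in> I" "x \<in> X j" by blast
    have "1 = (\<integral>\<^sup>+i. indicator {j} i \<partial>count_space I)"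
      using j by simp
    also have "\<dots> \<le> (\<integral>\<^sup>+i. indicator (X i) x \<partial>count_space I)"
      using j by (intro nn_integral_mono) (auto split: split_indicator)
    finally show ?thesis using True by simp
  qed simp
  have "emeasure M (\<Union>i\<in>I. X i) = (\<integral>\<^sup>+x. indicator (\<Union>i\<in>I. X i) x \<partial>M)"
    using I X by (intro nn_integral_indicator[symmetric] sets.countable_UN') auto
  also have "\<dots> \<le> (\<integral>\<^sup>+x. \<integral>\<^sup>+i. indicator (X i) x \<partial>count_space I \<partial>M)"
    by (intro nn_integral_mono le)
  also have "\<dots> = (\<integral>\<^sup>+i. \<integral>\<^sup>+x. indicator (X i) x \<partial>M \<partial>count_space I)"
    using I by (intro nn_integral_count_space_nn_integral) auto
  also have "\<dots> = (\<integral>\<^sup>+i. emeasure M (X i) \<partial>count_space I)"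
    by (intro nn_integral_cong) auto
  finally show ?thesis .
qed

text \<open>The Vitali lemma is applied with a fifth of the radii that have low density, so that the
  density bound holds for the enlarged balls.\<close>

lemma null_of_low_density:
  assumes M: "sets M = sets circle_borel"
    and N: "N \<in> sets circle_borel" "emeasure circle_lebesgue N = 0"
    and S: "S \<in> sets circle_borel" "S \<subseteq> N"
    and low: "\<And>x e. x \<in> S \<Longrightarrow> 0 < e \<Longrightarrow>
       \<exists>s. 0 < s \<and> s < e \<and> emeasure M (ball x s \<inter> sphere 0 1) \<le> ennreal (C * s)"
  shows "emeasure M S = 0"
proof -
  have "emeasure M S \<le> ennreal e" if e: "0 < e" for e
  proof -
    \<comment> \<open>C may be zero or negative, whereas D is positive and above C. The covering
      estimate below costs a factor 5 D, which fixes the size e / (5 D) demanded of V.\<close>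
    define D where "D = \<bar>C\<bar> + 1"
    have D: "0 < D" "C \<le> D" by (auto simp: D_def)
    obtain V where V: "open V" "N \<subseteq> V" "emeasure circle_lebesgue (V \<inter> sphere 0 1) < ennreal (e / (5 * D))"
      using circle_lebesgue_outer_regular[OF N, of "ennreal (e / (5 * D))"] e D by auto
    have "\<exists>r. 0 < r \<and> r \<le> 1 \<and> ball x r \<subseteq> V \<and> emeasure M (ball x (5 * r) \<inter> sphere 0 1) \<le> ennreal (5 * D * r)"
      if x: "x \<in> S" for x
    proof -
      obtain d where d: "0 < d" "ball x d \<subseteq> V"
        using V(1,2) S(2) x by (meson openE subsetD)
      obtain s where s: "0 < s" "s < min d 1" "emeasure M (ball x s \<inter> sphere 0 1) \<le> ennreal (C * s)"
        using low[OF x, of "min d 1"] d by auto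
      have "ennreal (C * s) \<le> ennreal (D * s)"
        using D s by (intro ennreal_leI mult_right_mono) auto
      with s d show ?thesis
        by (intro exI[of _ "s / 5"]) (auto intro: order_trans)
    qed
    then obtain r where r: "\<And>x. x \<in> S \<Longrightarrow> 0 < r x \<and> r x \<le> 1"
      "\<And>x. x \<in> S \<Longrightarrow> ball x (r x) \<subseteq> V"
      "\<And>x. x \<in> S \<Longrightarrow> emeasure M (ball x (5 * r x) \<inter> sphere 0 1) \<le> ennreal (5 * D * r x)"
      by metis
    have "S \<subseteq> (\<Union>x\<in>S. ball x (r x))" using r(1) by force
    from Vitali_covering_lemma_balls[OF this r(1)]
    obtain T where T: "countable T" "T \<subseteq> S"
      and pw: "pairwise (\<lambda>i j. disjnt (ball i (r i)) (ball j (r j))) T"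
      and cov: "S \<subseteq> (\<Union>i\<in>T. ball i (5 * r i))" by blast
    have S1: "S \<subseteq> sphere 0 1" using S(1) by (simp add: sets_circle_borel)
    have meas: "ball x s \<inter> sphere 0 1 \<in> sets circle_borel" for x s
      by (simp add: sets_circle_borel)
    have disj: "disjoint_family_on (\<lambda>i. ball i (r i) \<inter> sphere 0 1) T"
      using pw by (force simp: disjoint_family_on_def pairwise_def disjnt_def)
    have "emeasure M S \<le> emeasure M (\<Union>i\<in>T. ball i (5 * r i) \<inter> sphere 0 1)"
      using cov S1 by (intro emeasure_mono) (auto simp: M sets_circle_borel
        simp flip: UN_extend_simps intro!: sets.Int[OF borel_open borel_closed])
    also have "\<dots> \<le> (\<integral>\<^sup>+i. emeasure M (ball i (5 * r i) \<inter> sphere 0 1) \<partial>count_space T)"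
      using T meas by (intro emeasure_UN_le_nn_integral) (auto simp: M)
    also have "\<dots> \<le> (\<integral>\<^sup>+i. ennreal (5 * D) * emeasure circle_lebesgue (ball i (r i) \<inter> sphere 0 1) \<partial>count_space T)"
    proof (intro nn_integral_mono)
      fix i assume "i \<in> space (count_space T)"
      then have i: "i \<in> S" using T by auto
      have "emeasure M (ball i (5 * r i) \<inter> sphere 0 1) \<le> ennreal (5 * D) * ennreal (r i)"
        using r(3)[OF i] D r(1)[OF i] by (simp add: ennreal_mult)
      also have "\<dots> \<le> ennreal (5 * D) * emeasure circle_lebesgue (ball i (r i) \<inter> sphere 0 1)"
        using i S1 r(1)[OF i] by (intro mult_left_mono emeasure_circle_lebesgue_ball) auto
      finally show "emeasure M (ball i (5 * r i) \<inter> sphere 0 1)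
        \<le> ennreal (5 * D) * emeasure circle_lebesgue (ball i (r i) \<inter> sphere 0 1)" .
    qed
    \<comment> \<open>Only the small balls are disjoint. Passing to their arc length first lets the
      sum collapse to the measure of one subset of V.\<close>
    also have "\<dots> = ennreal (5 * D) * emeasure circle_lebesgue (\<Union>i\<in>T. ball i (r i) \<inter> sphere 0 1)"
      using T meas disj by (subst emeasure_UN_countable) (auto simp: nn_integral_cmult)
    also have "\<dots> \<le> ennreal (5 * D) * emeasure circle_lebesgue (V \<inter> sphere 0 1)"
      using r(2) T V(1) by (intro mult_left_mono emeasure_mono) (auto simp: sets_circle_borel)
    also have "\<dots> \<le> ennreal (5 * D) * ennreal (e / (5 * D))"
      using V(3) by (intro mult_left_mono) auto
    also have "\<dots> = ennreal e"
      using D e by (simp flip: ennreal_mult)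
    finally show ?thesis .
  qed
  note le = this
  have "emeasure M S \<le> 0"
    by (rule ennreal_le_epsilon) (simp add: le)
  then show ?thesis by simp
qed

section \<open>The Poisson integral of a Clark measure\<close>

lemma circle_sigma_sets: "sigma_sets (sphere 0 1) (sets circle_borel) = sets circle_borel"
  using sets.sigma_sets_eq[of circle_borel] by simp

lemma circle_measure_of_eq:
  assumes "\<And>A. A \<in> sets circle_borel \<Longrightarrow> f A = g A"
  shows "measure_of (sphere 0 1) (sets circle_borel) f = measure_of (sphere 0 1) (sets circle_borel) g"
  using assms sets.space_closed[of circle_borel] by (intro measure_of_eq) (auto simp: circle_sigma_sets)

text \<open>\<open>ennreal\<close> sends negative reals to 0, so the supremum is 0. This removes the
  negative part of a nonnegative set function and both parts of a vanishing one.\<close>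

lemma pos_variation_nonpos:
  assumes "\<And>A. A \<in> sets circle_borel \<Longrightarrow> l A \<le> 0"
  shows "pos_variation l = null_measure circle_borel"
  unfolding pos_variation_def null_measure_def space_circle_borel
  using assms by (intro circle_measure_of_eq antisym SUP_least) (auto simp: ennreal_neg)

text \<open>Instantiated by the diagonal entries of a matrix measure and by their sum, the trace.
  For these the Jordan decomposition collapses to an ordinary finite measure.\<close>

locale nonneg_circle_premeasure =
  fixes l :: "complex set \<Rightarrow> real"
  assumes nonneg: "A \<in> sets circle_borel \<Longrightarrow> 0 \<le> l A"
    and sums: "range F \<subseteq> sets circle_borel \<Longrightarrow> disjoint_family F \<Longrightarrow> (\<lambda>k. l (F k)) sums l (\<Union>k. F k)"
begin

lemma empty: "l {} = 0"
proof -
  \<comment> \<open>The empty set is a disjoint union of infinitely many copies of itself, and a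
    constant series converges only if its terms are 0.\<close>
  have "(\<lambda>k::nat. l {}) sums l (\<Union>k::nat. {})"
    by (intro sums) (auto simp: disjoint_family_on_def)
  then have "(\<lambda>k::nat. l {}) \<longlonglongrightarrow> 0"
    by (intro summable_LIMSEQ_zero) (rule sums_summable)
  then show ?thesis by (simp add: LIMSEQ_const_iff)
qed

lemma mono:
  assumes "A \<in> sets circle_borel" "B \<in> sets circle_borel" "A \<subseteq> B"
  shows "l A \<le> l B"
proof -
  let ?F = "\<lambda>k::nat. if k = 0 then A else if k = 1 then B - A else {}"
  have "(\<lambda>k. l (?F k)) sums l (\<Union>k. ?F k)"
    using assms by (intro sums) (auto simp: disjoint_family_on_def)
  moreover have "(\<Union>k. ?F k) = B"
    using assms(3) by (auto split: if_splits)
  moreover have "(\<lambda>k. l (?F k)) sums (\<Sum>k\<in>{0, 1}. l (?F k))"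
    by (intro sums_finite) (auto simp: empty)
  ultimately have "l B = l A + l (B - A)"
    using sums_unique2 by fastforce
  then show ?thesis
    using nonneg[of "B - A"] assms by simp
qed

lemma emeasure_measure_of:
  assumes "A \<in> sets circle_borel"
  shows "emeasure (measure_of (sphere 0 1) (sets circle_borel) (\<lambda>A. ennreal (l A))) A = ennreal (l A)"
proof (rule emeasure_measure_of_sigma[OF _ _ _ assms])
  show "sigma_algebra (sphere 0 1) (sets circle_borel)"
    using sets.sigma_algebra_axioms[of circle_borel] by simp
  show "positive (sets circle_borel) (\<lambda>A. ennreal (l A))"
    by (simp add: positive_def empty)
  show "countably_additive (sets circle_borel) (\<lambda>A. ennreal (l A))"
    using sums nonneg by (intro countably_additiveI suminf_ennreal_eq) auto
qed

lemma pos_variation: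
  "pos_variation l = measure_of (sphere 0 1) (sets circle_borel) (\<lambda>A. ennreal (l A))"
  unfolding pos_variation_def
  using mono by (intro circle_measure_of_eq antisym SUP_least SUP_upper) (auto intro: ennreal_leI)

lemma sets_pos_variation: "sets (pos_variation l) = sets circle_borel"
  using sets.space_closed[of circle_borel] by (simp add: pos_variation circle_sigma_sets)

lemma emeasure_pos_variation:
  "A \<in> sets circle_borel \<Longrightarrow> emeasure (pos_variation l) A = ennreal (l A)"
  by (simp add: pos_variation emeasure_measure_of)

lemma finite_measure: "finite_measure (pos_variation l)"
  using emeasure_pos_variation[OF sets.top[of circle_borel]]
  by (intro finite_measureI) (simp add: space_circle_measure[OF sets_pos_variation])

lemma signed_integral: "signed_integral l f = integral\<^sup>L (pos_variation l) f"
  using nonneg by (simp add: signed_integral_def pos_variation_nonpos)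

end

section \<open>Diagonal entries and trace of a matrix measure\<close>

lemma diagonal_entry_premeasure:
  fixes \<mu> :: "complex set \<Rightarrow> complex^'n^'n"
  assumes "matrix_measure \<mu>"
  shows "nonneg_circle_premeasure (\<lambda>A. Re (\<mu> A $ i $ i))"
proof
  fix A assume "A \<in> sets circle_borel"
  then have "0 \<le> Re (quad_form (\<mu> A) (axis i 1))"
    using assms by (auto simp: matrix_measure_def pos_semidefinite_def)
  also have "Re (quad_form (\<mu> A) (axis i 1)) = Re (\<mu> A $ i $ i)"
    by (simp add: quad_form_def axis_def matrix_vector_mult_def if_distrib if_distribR cong: if_cong)
  finally show "0 \<le> Re (\<mu> A $ i $ i)" .
next
  fix A :: "nat \<Rightarrow> complex set"
  assume "range A \<subseteq> sets circle_borel" "disjoint_family A"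
  then have "(\<lambda>k. \<mu> (A k)) sums \<mu> (\<Union>k. A k)"
    using assms by (auto simp: matrix_measure_def)
  moreover have "bounded_linear (\<lambda>M::complex^'n^'n. Re (M $ i $ i))"
    by (intro bounded_linear_compose[OF bounded_linear_Re]
        bounded_linear_compose[OF bounded_linear_vec_nth] bounded_linear_vec_nth)
  ultimately show "(\<lambda>k. Re (\<mu> (A k) $ i $ i)) sums Re (\<mu> (\<Union>k. A k) $ i $ i)"
    using bounded_linear.sums by blast
qed

text \<open>Hermitian values have real diagonal, so the imaginary part integrates to 0 and
  nonnegativity leaves only the positive variation.\<close>

lemma diagonal_entry_integral:
  assumes "matrix_measure \<mu>"
  shows "complex_measure_integral (\<lambda>A. \<mu> A $ i $ i) f
    = integral\<^sup>L (pos_variation (\<lambda>A. Re (\<mu> A $ i $ i))) f"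
proof -
  interpret nonneg_circle_premeasure "\<lambda>A. Re (\<mu> A $ i $ i)"
    using assms by (rule diagonal_entry_premeasure)
  have "Im (\<mu> A $ i $ i) = 0" if "A \<in> sets circle_borel" for A
  proof -
    have "adj (\<mu> A) $ i $ i = \<mu> A $ i $ i"
      using assms that by (auto simp: matrix_measure_def pos_semidefinite_def)
    then show ?thesis
      by (simp add: adj_def map_matrix_def transpose_def complex_eq_iff)
  qed
  then have "signed_integral (\<lambda>A. Im (\<mu> A $ i $ i)) f = 0"
    by (simp add: signed_integral_def pos_variation_nonpos)
  then show ?thesis
    by (simp add: complex_measure_integral_def signed_integral)
qed

lemma sets_trace_measure [simp]: "sets (trace_measure \<mu>) = sets circle_borel"
  using sets.space_closed[of circle_borel] by (simp add: trace_measure_def circle_sigma_sets)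

lemma emeasure_trace_measure:
  assumes \<mu>: "matrix_measure \<mu>" and A: "A \<in> sets circle_borel"
  shows "emeasure (trace_measure \<mu>) A = ennreal (\<Sum>i\<in>UNIV. Re (\<mu> A $ i $ i))"
proof -
  interpret nonneg_circle_premeasure "\<lambda>A. Re (\<mu> A $ i $ i)" for i
    using \<mu> by (rule diagonal_entry_premeasure)
  interpret tr: nonneg_circle_premeasure "\<lambda>A. \<Sum>i\<in>UNIV. Re (\<mu> A $ i $ i)"
    by unfold_locales (auto intro!: sum_nonneg nonneg sums_sum sums)
  show ?thesis
    using tr.emeasure_measure_of[OF A] by (simp add: trace_measure_def trace_def)
qed

section \<open>Poisson kernel and growth of the Clark transform along radii\<close>

lemma Re_herglotz_kernel:
  assumes "norm \<zeta> = 1" "norm z < 1"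
  shows "Re ((\<zeta> + z) / (\<zeta> - z)) = (1 - (norm z)\<^sup>2) / (norm (\<zeta> - z))\<^sup>2"
proof -
  have "(\<zeta> + z) / (\<zeta> - z) = (\<zeta> + z) * cnj (\<zeta> - z) / of_real ((norm (\<zeta> - z))\<^sup>2)"
    by (rule complex_div_cnj)
  moreover have "Re ((\<zeta> + z) * cnj (\<zeta> - z)) = (norm \<zeta>)\<^sup>2 - (norm z)\<^sup>2"
    unfolding cmod_power2 by (simp add: algebra_simps power2_eq_square)
  ultimately show ?thesis using assms(1) by (simp add: Re_divide_of_real)
qed

text \<open>Put z = (1 - s) x. On the ball of radius s about x one has |\<zeta> - z| <= 2 s, while 1
  - |z|^2 >= s, so the Poisson kernel is at least s / (2 s)^2 = 1 / (4 s). Elsewhere on the circle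
  it is nonnegative.\<close>

lemma herglotz_integral_lower:
  assumes M: "sets M = sets circle_borel" "finite_measure M"
    and x: "norm x = 1" and s: "0 < s" "s \<le> 1"
  shows "measure M (ball x s \<inter> sphere 0 1) / (4 * s)
    \<le> Re (\<integral>\<zeta>. (\<zeta> + (1 - s) *\<^sub>R x) / (\<zeta> - (1 - s) *\<^sub>R x) \<partial>M)"
proof -
  interpret finite_measure M by fact
  define z where "z = (1 - s) *\<^sub>R x"
  define f where "f = (\<lambda>\<zeta>. (\<zeta> + z) / (\<zeta> - z))"
  have z: "norm z = 1 - s" using x s by (simp add: z_def)
  have sp: "space M = sphere 0 1" using M(1) by (rule space_circle_measure)
  have "f \<in> borel_measurable circle_borel"
    unfolding f_def circle_borel_def by (intro measurable_restrict_space1) measurable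
  then have meas: "f \<in> borel_measurable M"
    by (simp add: measurable_cong_sets[OF M(1) refl])
  have bound: "norm (f \<zeta>) \<le> 2 / s" if "norm \<zeta> = 1" for \<zeta>
  proof -
    have "norm (\<zeta> + z) \<le> 2" "s \<le> norm (\<zeta> - z)"
      using norm_triangle_ineq[of \<zeta> z] norm_triangle_ineq2[of \<zeta> z] z that s by auto
    then show ?thesis unfolding f_def norm_divide using s by (intro frac_le) auto
  qed
  have int: "integrable M f"
    using meas bound by (intro integrable_const_bound[where B = "2 / s"]) (auto simp: sp)
  have I: "ball x s \<inter> sphere 0 1 \<in> sets M"
    by (simp add: M(1) sets_circle_borel)
  have "measure M (ball x s \<inter> sphere 0 1) / (4 * s)
      = (\<integral>\<zeta>. indicator (ball x s \<inter> sphere 0 1) \<zeta> / (4 * s) \<partial>M)"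
    using I by simp
  also have "\<dots> \<le> (\<integral>\<zeta>. Re (f \<zeta>) \<partial>M)"
  proof (intro integral_mono integrable_Re int)
    show "integrable M (\<lambda>\<zeta>. indicator (ball x s \<inter> sphere 0 1) \<zeta> / (4 * s))"
      using I by (intro integrable_divide integrable_real_indicator) (auto simp: less_top[symmetric])
    fix \<zeta> assume "\<zeta> \<in> space M"
    then have \<zeta>: "norm \<zeta> = 1" by (simp add: sp)
    have Re: "Re (f \<zeta>) = (1 - (norm z)\<^sup>2) / (norm (\<zeta> - z))\<^sup>2"
      unfolding f_def using \<zeta> z s by (intro Re_herglotz_kernel) auto
    show "indicator (ball x s \<inter> sphere 0 1) \<zeta> / (4 * s) \<le> Re (f \<zeta>)"
    proof (cases "\<zeta> \<in> ball x s")
      case True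
      have "norm (\<zeta> - z) \<le> norm (\<zeta> - x) + norm (x - z)"
        using norm_triangle_ineq[of "\<zeta> - x" "x - z"] by simp
      also have "x - z = s *\<^sub>R x" by (simp add: z_def algebra_simps)
      finally have "norm (\<zeta> - z) \<le> 2 * s"
        using True x s by (simp add: dist_norm norm_minus_commute)
      moreover have "\<zeta> \<noteq> z" using \<zeta> z s by auto
      ultimately have "(norm (\<zeta> - z))\<^sup>2 \<le> (2 * s)\<^sup>2" and "0 < (norm (\<zeta> - z))\<^sup>2"
        by (simp_all only: power_mono norm_ge_zero zero_less_power zero_less_norm_iff right_minus_eq not_False_eq_True)
      moreover have "s \<le> 1 - (norm z)\<^sup>2"
        using s mult_left_mono[of s 1 s] by (simp add: z power2_eq_square algebra_simps)
      ultimately have "s / (2 * s)\<^sup>2 \<le> Re (f \<zeta>)"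
        unfolding Re using s by (intro frac_le) auto
      then show ?thesis
        using True \<zeta> s by (simp add: power2_eq_square)
    next
      case False
      then show ?thesis using s z by (simp add: Re power_le_one)
    qed
  qed
  also have "\<dots> = Re (\<integral>\<zeta>. f \<zeta> \<partial>M)"
    using int by simp
  finally show ?thesis unfolding f_def z_def .
qed

text \<open>\<open>Im_matrix A\<close> is Hermitian, so i times it has imaginary trace. This drops
  the constant term of the Herglotz representation.\<close>

lemma Re_trace_skew: "Re (trace (cscale \<i> (Im_matrix A))) = 0"
  by (simp add: trace_def cscale_def map_matrix_def Im_matrix_def adj_def transpose_def)

text \<open>The real part of the trace of the Herglotz representation involves only the diagonal
  entries, and the Poisson bound is summed over them. Wherever the transform stays bounded at
  distance s from the circle, the density at scale s is bounded too.\<close>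

lemma clark_trace_lower:
  assumes c: "clark_measure b U \<mu>"
    and x: "norm x = 1" and s: "0 < s" "s \<le> 1"
  shows "emeasure (trace_measure \<mu>) (ball x s \<inter> sphere 0 1)
    \<le> ennreal (4 * Re (trace (clark_transform b U ((1 - s) *\<^sub>R x))) * s)"
proof -
  define z where "z = (1 - s) *\<^sub>R x"
  have \<mu>: "matrix_measure \<mu>" using c by (simp add: clark_measure_def)
  interpret nonneg_circle_premeasure "\<lambda>A. Re (\<mu> A $ i $ i)" for i
    using \<mu> by (rule diagonal_entry_premeasure)
  have I: "ball x s \<inter> sphere 0 1 \<in> sets circle_borel"
    by (simp add: sets_circle_borel)
  have "z \<in> ball 0 1" using x s by (simp add: z_def)
  then have eq: "clark_transform b U z = cscale \<i> (Im_matrix (clark_transform b U 0)) +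
      matrix_integral \<mu> (\<lambda>\<zeta>. (\<zeta> + z) / (\<zeta> - z))"
    using c unfolding clark_measure_def by blast
  have "Re (trace (clark_transform b U z))
      = Re (trace (matrix_integral \<mu> (\<lambda>\<zeta>. (\<zeta> + z) / (\<zeta> - z))))"
    unfolding eq by (simp add: trace_add Re_trace_skew)
  also have "\<dots> = (\<Sum>i\<in>UNIV. Re (\<integral>\<zeta>. (\<zeta> + z) / (\<zeta> - z) \<partial>pos_variation (\<lambda>A. Re (\<mu> A $ i $ i))))"
    by (simp add: trace_def matrix_integral_def diagonal_entry_integral[OF \<mu>])
  also have "\<dots> \<ge> (\<Sum>i\<in>UNIV. measure (pos_variation (\<lambda>A. Re (\<mu> A $ i $ i))) (ball x s \<inter> sphere 0 1) / (4 * s))"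
    unfolding z_def using x s by (intro sum_mono herglotz_integral_lower sets_pos_variation finite_measure)
  also have "(\<Sum>i\<in>UNIV. measure (pos_variation (\<lambda>A. Re (\<mu> A $ i $ i))) (ball x s \<inter> sphere 0 1) / (4 * s))
      = (\<Sum>i\<in>UNIV. Re (\<mu> (ball x s \<inter> sphere 0 1) $ i $ i)) / (4 * s)"
    using nonneg[OF I] by (simp add: measure_def emeasure_pos_variation I sum_divide_distrib)
  finally show ?thesis
    using s by (simp add: emeasure_trace_measure \<mu> I z_def field_simps ennreal_leI)
qed

section \<open>Resonance sets\<close>

lemma norm_det_le:
  fixes A :: "complex^'n^'n"
  assumes "\<And>i j. norm (A $ i $ j) \<le> c"
  shows "norm (det A) \<le> real (card {p. p permutes (UNIV::'n set)}) * c ^ CARD('n)"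
proof -
  have "norm (of_int (sign p) * (\<Prod>i\<in>UNIV. A $ i $ p i)) \<le> c ^ CARD('n)" for p :: "'n \<Rightarrow> 'n"
  proof -
    have "norm (\<Prod>i\<in>UNIV. A $ i $ p i) \<le> (\<Prod>i\<in>(UNIV::'n set). c)"
      unfolding prod_norm[symmetric] using assms by (intro prod_mono) auto
    moreover have "norm (of_int (sign p) :: complex) = 1"
      by (simp add: sign_def)
    ultimately show ?thesis by (simp add: norm_mult)
  qed
  then show ?thesis
    unfolding det_def by (intro order_trans[OF norm_sum] sum_bounded_above)
qed

lemma norm_entry_le:
  fixes A :: "complex^'n^'n"
  assumes "\<And>v. norm (A *v v) \<le> norm v"
  shows "norm (A $ i $ j) \<le> 1"
proof -
  have "A $ i $ j = (A *v axis j 1) $ i"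
    by (simp add: matrix_vector_mult_def axis_def if_distrib cong: if_cong)
  also have "norm \<dots> \<le> norm (axis j (1::complex))"
    using assms Finite_Cartesian_Product.norm_nth_le order_trans by blast
  finally show ?thesis by simp
qed

text \<open>Entries of a contraction have modulus at most 1, so those of 1 + w and 1 - w have
  modulus at most 2. Cramer's rule writes each entry of the inverse as such a determinant divided by
  det (1 - w), and the trace is a sum of n^2 products.\<close>

lemma trace_cayley_bound:
  obtains K where "0 \<le> K"
    "\<And>w :: complex^'n^'n. (\<And>v. norm (w *v v) \<le> norm v) \<Longrightarrow> det (mat 1 - w) \<noteq> 0 \<Longrightarrow>
      norm (trace ((mat 1 + w) ** matrix_inv (mat 1 - w))) \<le> K / norm (det (mat 1 - w))"
proof
  \<comment> \<open>The Leibniz formula bounds a determinant with entries of modulus at most 2 by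
    the number of permutations times 2^n.\<close>
  define P where "P = real (card {p. p permutes (UNIV::'n set)}) * 2 ^ CARD('n)"
  have P: "0 \<le> P" by (simp add: P_def)
  show "0 \<le> real CARD('n) * (real CARD('n) * (2 * P))" using P by simp
  fix w :: "complex^'n^'n"
  assume w: "\<And>v. norm (w *v v) \<le> norm v" and d: "det (mat 1 - w) \<noteq> 0"
  let ?A = "mat 1 - w"
  let ?X = "matrix_inv ?A"
  have inv: "?A ** ?X = mat 1"
    using d by (simp add: matrix_mul_matrix_inv invertible_det_nz)
  have one: "norm ((mat 1 :: complex^'n^'n) $ i $ j) \<le> 1" for i j
    by (simp add: mat_def)
  have A: "norm (?A $ i $ j) \<le> 2" for i j
    using norm_triangle_ineq4[of "mat 1 $ i $ j" "w $ i $ j"] norm_entry_le[OF w, of i j] one[of i j] by simp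
  have W: "norm ((mat 1 + w) $ i $ j) \<le> 2" for i j
    using norm_triangle_ineq[of "mat 1 $ i $ j" "w $ i $ j"] norm_entry_le[OF w, of i j] one[of i j] by simp
  have X: "norm (?X $ k $ j) \<le> P / norm (det ?A)" for k j
  proof -
    have "?A *v (?X *v axis j 1) = axis j 1"
      by (simp add: matrix_vector_mul_assoc inv)
    then have "(?X *v axis j 1) $ k = det (\<chi> i l. if l = k then axis j 1 $ i else ?A $ i $ l) / det ?A"
      using cramer[OF d, of "?X *v axis j 1" "axis j 1"] by simp
    moreover have "(?X *v axis j 1) $ k = ?X $ k $ j"
      by (simp add: matrix_vector_mult_def axis_def if_distrib cong: if_cong)
    moreover have "norm (det (\<chi> i l. if l = k then axis j 1 $ i else ?A $ i $ l)) \<le> P"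
      unfolding P_def using A by (intro norm_det_le) (auto simp: axis_def)
    ultimately show ?thesis by (simp add: norm_divide divide_right_mono)
  qed
  have "norm (trace ((mat 1 + w) ** ?X)) \<le> (\<Sum>i\<in>(UNIV::'n set). \<Sum>k\<in>(UNIV::'n set). 2 * (P / norm (det ?A)))"
    unfolding trace_def matrix_matrix_mult_def
    using W X P by (simp only: vec_lambda_beta) (intro order_trans[OF norm_sum] sum_mono; simp only: norm_mult; intro mult_mono; simp)
  then show "norm (trace ((mat 1 + w) ** ?X)) \<le> real CARD('n) * (real CARD('n) * (2 * P)) / norm (det ?A)"
    by simp
qed

section \<open>Schur functions along radii\<close>

lemma schur_contraction:
  assumes "b \<in> schur_class" "z \<in> ball 0 1"
  shows "norm (b z *v v) \<le> norm v"
proof -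
  have "norm (b z *v v) \<le> op_norm (b z) * norm v"
    unfolding op_norm_def by (rule onorm[OF matrix_vector_mul_bounded_linear])
  also have "\<dots> \<le> 1 * norm v"
    using assms by (intro mult_right_mono) (auto simp: schur_class_def less_imp_le)
  finally show ?thesis by simp
qed

lemma schur_continuous:
  assumes "b \<in> schur_class"
  shows "continuous_on (ball 0 1) b"
proof -
  have "continuous_on (ball 0 1) (\<lambda>z. \<chi> i j. b z $ i $ j)"
    using assms by (intro continuous_on_vec_lambda holomorphic_on_imp_continuous_on) (auto simp: schur_class_def)
  then show ?thesis by simp
qed

lemma continuous_on_det_resolvent:
  "continuous_on UNIV (\<lambda>A::complex^'n^'n. det (mat 1 - A ** V))"
  unfolding det_def matrix_matrix_mult_def by (simp, intro continuous_intros)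

text \<open>A sequence of radii in place of a continuous radius keeps all quantifiers countable, so
  resonance sets are Borel.\<close>

definition radial_gap :: "nat \<Rightarrow> real" where
  "radial_gap j = inverse (real (Suc j))"

lemma radial_gap: "0 < radial_gap j" "radial_gap j \<le> 1"
  by (auto simp: radial_gap_def divide_simps)

lemma radial_gap_tendsto: "radial_gap \<longlonglongrightarrow> 0"
  unfolding radial_gap_def by (rule LIMSEQ_inverse_real_of_nat)

definition radial_det :: "(complex \<Rightarrow> complex^'n^'n) \<Rightarrow> complex^'n^'n \<Rightarrow> nat \<Rightarrow> complex \<Rightarrow> complex" where
  "radial_det b U j x = det (mat 1 - b ((1 - radial_gap j) *\<^sub>R x) ** adj U)"

definition resonance_set :: "(complex \<Rightarrow> complex^'n^'n) \<Rightarrow> complex^'n^'n \<Rightarrow> complex set" where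
  "resonance_set b U = {x \<in> sphere 0 1. (\<lambda>j. radial_det b U j x) \<longlonglongrightarrow> 0}"

lemma radial_point:
  fixes x :: complex
  shows "x \<in> sphere 0 1 \<Longrightarrow> (1 - radial_gap j) *\<^sub>R x \<in> ball 0 1"
  using radial_gap[of j] by simp

lemma radial_det_measurable:
  assumes "b \<in> schur_class"
  shows "radial_det b U j \<in> borel_measurable circle_borel"
proof -
  have "continuous_on (sphere 0 1) (\<lambda>x. b ((1 - radial_gap j) *\<^sub>R x))"
    using radial_point by (intro continuous_on_compose2[OF schur_continuous[OF assms]] continuous_intros) blast
  then have "continuous_on (sphere 0 1) (radial_det b U j)"
    unfolding radial_det_def using continuous_on_compose2[OF continuous_on_det_resolvent] by blast
  then show ?thesis
    unfolding circle_borel_def by (rule borel_measurable_continuous_on_restrict)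
qed

lemma resonance_set_measurable:
  assumes "b \<in> schur_class"
  shows "resonance_set b U \<in> sets circle_borel"
proof -
  note [measurable] = radial_det_measurable[OF assms]
  \<comment> \<open>Thresholds 1 / (m + 1) replace arbitrary positive reals to make convergence a
    countable condition.\<close>
  have "resonance_set b U = {x \<in> space circle_borel.
      \<forall>m. \<exists>J. \<forall>j\<ge>J. norm (radial_det b U j x) < inverse (real (Suc m))}"
    unfolding resonance_set_def space_circle_borel LIMSEQ_def dist_norm diff_zero
  proof (intro Collect_cong conj_cong refl iffI allI impI)
    fix x e
    assume "\<forall>m. \<exists>J. \<forall>j\<ge>J. norm (radial_det b U j x) < inverse (real (Suc m))"
    moreover assume "(0::real) < e"
    then obtain m where "inverse (real (Suc m)) < e" using reals_Archimedean by blast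
    ultimately show "\<exists>J. \<forall>j\<ge>J. norm (radial_det b U j x) < e" by (meson less_trans)
  qed simp
  also have "\<dots> \<in> sets circle_borel" by measurable
  finally show ?thesis .
qed

text \<open>The cluster point B is extracted at x before any t is considered, so one matrix serves
  all times. In the limit the strict norm bound becomes a weak one, and continuity of the
  determinant turns convergence to 0 into vanishing at B.\<close>

lemma finite_resonance_times:
  fixes \<alpha> :: "real \<Rightarrow> complex^'n^'n"
  assumes b: "b \<in> schur_class"
    and U: "\<And>t. unitary (\<alpha> t)"
    and D: "\<And>t. (\<alpha> has_vector_derivative \<alpha>' t) (at t)"
    and sd: "\<And>t. sign_definite (cscale \<i> (\<alpha>' t ** matrix_inv (\<alpha> t)))"
    and "bounded T"
  shows "finite {t \<in> T. x \<in> resonance_set b (\<alpha> t)}"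
proof (cases "x \<in> sphere 0 1")
  case x: True
  define c where "c = (\<lambda>j. b ((1 - radial_gap j) *\<^sub>R x))"
  have "bounded (b ` ball 0 1)" using b by (simp add: schur_class_def)
  moreover have "range c \<subseteq> b ` ball 0 1"
    using radial_point[OF x] by (auto simp: c_def)
  ultimately have "bounded (range c)" using bounded_subset by blast
  then obtain B r where r: "strict_mono r" "(c \<circ> r) \<longlonglongrightarrow> B"
    using bounded_imp_convergent_subsequence by blast
  have "norm (B *v v) \<le> norm v" for v
  proof (rule tendsto_upperbound)
    show "(\<lambda>k. norm ((c \<circ> r) k *v v)) \<longlonglongrightarrow> norm (B *v v)"
      using bounded_bilinear.tendsto[OF bounded_bilinear_matrix_vector r(2) tendsto_const]
      by (rule tendsto_norm)
    show "\<forall>\<^sub>F k in sequentially. norm ((c \<circ> r) k *v v) \<le> norm v"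
      using schur_contraction[OF b radial_point[OF x]] by (simp add: c_def)
  qed simp
  then show ?thesis
  proof (rule finite_resonance[OF _ U D sd])
    show "bounded {t \<in> T. x \<in> resonance_set b (\<alpha> t)}"
      using \<open>bounded T\<close> by (rule bounded_subset) auto
    fix t assume "t \<in> {t \<in> T. x \<in> resonance_set b (\<alpha> t)}"
    then have "(\<lambda>j. det (mat 1 - c j ** adj (\<alpha> t))) \<longlonglongrightarrow> 0"
      by (simp add: resonance_set_def radial_det_def c_def)
    then have "(\<lambda>k. det (mat 1 - (c \<circ> r) k ** adj (\<alpha> t))) \<longlonglongrightarrow> 0"
      using LIMSEQ_subseq_LIMSEQ[OF _ r(1)] by (auto simp: o_def)
    moreover have "(\<lambda>k. det (mat 1 - (c \<circ> r) k ** adj (\<alpha> t))) \<longlonglongrightarrow> det (mat 1 - B ** adj (\<alpha> t))"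
      using continuous_on_tendsto_compose[OF continuous_on_det_resolvent r(2)] by simp
    ultimately show "det (mat 1 - B ** adj (\<alpha> t)) = 0"
      using LIMSEQ_unique by blast
  qed
qed (simp add: resonance_set_def)

text \<open>Off the resonance set the determinant exceeds some 1 / (m + 1) in modulus at arbitrarily
  small gaps. There the Cayley bound gives Re tr H <= K (m + 1), hence density at most 4 K (m + 1),
  and \<open>null_of_low_density\<close> applies for each m.\<close>

lemma trace_measure_null:
  fixes b :: "complex \<Rightarrow> complex^'n^'n"
  assumes b: "b \<in> schur_class" and U: "unitary U" and c: "clark_measure b U \<mu>"
    and N: "N \<in> sets circle_borel" "emeasure circle_lebesgue N = 0"
  shows "emeasure (trace_measure \<mu>) (N - resonance_set b U) = 0"
proof -
  obtain K where K: "0 \<le> K"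
    "\<And>w :: complex^'n^'n. (\<And>v. norm (w *v v) \<le> norm v) \<Longrightarrow> det (mat 1 - w) \<noteq> 0 \<Longrightarrow>
      norm (trace ((mat 1 + w) ** matrix_inv (mat 1 - w))) \<le> K / norm (det (mat 1 - w))"
    using trace_cayley_bound by blast
  note [measurable] = radial_det_measurable[OF b]
  define S where "S m = {x \<in> N. \<forall>J. \<exists>j\<ge>J. inverse (real (Suc m)) \<le> norm (radial_det b U j x)}" for m
  have N1: "N \<subseteq> sphere 0 1" using N(1) by (simp add: sets_circle_borel)
  have S: "S m \<in> sets circle_borel" for m
  proof -
    have "S m = N \<inter> {x \<in> space circle_borel. \<forall>J. \<exists>j\<ge>J. inverse (real (Suc m)) \<le> norm (radial_det b U j x)}"
      using N1 by (auto simp: S_def)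
    also have "\<dots> \<in> sets circle_borel"
      by (intro sets.Int N(1)) measurable
    finally show ?thesis .
  qed
  have "emeasure (trace_measure \<mu>) (S m) = 0" for m
  proof (rule null_of_low_density[OF _ N S])
    show "S m \<subseteq> N" by (auto simp: S_def)
    fix x and e :: real assume x: "x \<in> S m" and "0 < e"
    then have x1: "x \<in> sphere 0 1" using N1 by (auto simp: S_def)
    obtain J where J: "\<And>j. J \<le> j \<Longrightarrow> radial_gap j < e"
      using order_tendstoD(2)[OF radial_gap_tendsto \<open>0 < e\<close>] by (auto simp: eventually_sequentially)
    obtain j where j: "J \<le> j" "inverse (real (Suc m)) \<le> norm (radial_det b U j x)"
      using x by (auto simp: S_def simp del: of_nat_Suc)
    \<comment> \<open>The Clark transform at this point is the Cayley transform of w, which is a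
      contraction as a product of a contraction and a unitary.\<close>
    define w where "w = b ((1 - radial_gap j) *\<^sub>R x) ** adj U"
    have w: "norm (w *v v) \<le> norm v" for v
      using schur_contraction[OF b radial_point[OF x1], of j "adj U *v v"] unitary_norm[OF unitary_adj[OF U], of v]
      by (simp add: w_def matrix_vector_mul_assoc)
    have d: "inverse (real (Suc m)) \<le> norm (det (mat 1 - w))"
      using j(2) by (simp add: radial_det_def w_def)
    have pos: "0 < inverse (real (Suc m))" by simp
    have "det (mat 1 - w) \<noteq> 0" using d pos by (auto simp del: of_nat_Suc)
    have "Re (trace (clark_transform b U ((1 - radial_gap j) *\<^sub>R x))) \<le> K / norm (det (mat 1 - w))"
      using K(2)[OF w \<open>det (mat 1 - w) \<noteq> 0\<close>] complex_Re_le_cmod order_trans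
      unfolding clark_transform_def w_def by blast
    also have "\<dots> \<le> K / inverse (real (Suc m))"
      using d pos K(1) by (intro divide_left_mono mult_pos_pos) auto
    finally have "4 * Re (trace (clark_transform b U ((1 - radial_gap j) *\<^sub>R x))) * radial_gap j
        \<le> 4 * (K / inverse (real (Suc m))) * radial_gap j"
      using radial_gap[of j] by (intro mult_right_mono mult_left_mono) auto
    then have "emeasure (trace_measure \<mu>) (ball x (radial_gap j) \<inter> sphere 0 1)
        \<le> ennreal (4 * (K / inverse (real (Suc m))) * radial_gap j)"
      using clark_trace_lower[OF c _ radial_gap, of x j] x1 by (meson ennreal_leI mem_sphere_0 order_trans)
    with J[OF j(1)] radial_gap(1)[of j]
    show "\<exists>s. 0 < s \<and> s < e \<and> emeasure (trace_measure \<mu>) (ball x s \<inter> sphere 0 1)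
        \<le> ennreal (4 * (K / inverse (real (Suc m))) * s)"
      by blast
  qed simp
  then have "emeasure (trace_measure \<mu>) (\<Union>m. S m) = 0"
    using S by (intro emeasure_UN_eq_0) auto
  moreover have "N - resonance_set b U \<subseteq> (\<Union>m. S m)"
  proof
    fix x assume x: "x \<in> N - resonance_set b U"
    then have "\<not> (\<lambda>j. radial_det b U j x) \<longlonglongrightarrow> 0"
      using N1 by (auto simp: resonance_set_def)
    then obtain e where e: "0 < e" "\<And>J. \<exists>j\<ge>J. e \<le> norm (radial_det b U j x)"
      by (auto simp: LIMSEQ_def not_less)
    obtain m where "inverse (real (Suc m)) < e"
      using reals_Archimedean[OF e(1)] by blast
    then have "x \<in> S m"
      using x e(2) unfolding S_def by (simp del: of_nat_Suc) (meson less_imp_le order_trans)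
    then show "x \<in> (\<Union>m. S m)" by blast
  qed
  ultimately show ?thesis
    using S emeasure_mono[of "N - resonance_set b U" "\<Union>m. S m" "trace_measure \<mu>"] by auto
qed

text \<open>Suppose infinitely many times in [-m, m] had sets of measure at least 1 / (k + 1). By
  continuity from above their limit superior would have at least that measure, so it would contain a
  point lying in infinitely many of the sets, against \<open>fin\<close>.\<close>

lemma countable_positive_measure:
  fixes E :: "real \<Rightarrow> 'a set"
  assumes "finite_measure M"
    and E: "\<And>t. E t \<in> sets M"
    and fin: "\<And>x T. bounded T \<Longrightarrow> finite {t \<in> T. x \<in> E t}"
  shows "countable {t. emeasure M (E t) \<noteq> 0}"
proof -
  interpret finite_measure M by fact
  define A where "A m k = {t. \<bar>t\<bar> \<le> real m \<and> inverse (real (Suc k)) \<le> measure M (E t)}" for m k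
  have "finite (A m k)" for m k
  proof (rule ccontr)
    assume "infinite (A m k)"
    then obtain f :: "nat \<Rightarrow> real" where f: "inj f" "range f \<subseteq> A m k"
      using infinite_countable_subset by blast
    define G where "G n = (\<Union>i\<in>{n..}. E (f i))" for n
    have G: "G n \<in> sets M" for n
      using E by (auto simp: G_def)
    have "(\<lambda>n. measure M (G n)) \<longlonglongrightarrow> measure M (\<Inter>n. G n)"
      using G by (intro finite_Lim_measure_decseq) (auto simp: decseq_def G_def intro: order_trans)
    moreover have "inverse (real (Suc k)) \<le> measure M (G n)" for n
    proof -
      have "inverse (real (Suc k)) \<le> measure M (E (f n))"
        using f(2) by (auto simp: A_def)
      also have "\<dots> \<le> measure M (G n)"
        using G by (intro finite_measure_mono) (auto simp: G_def)
      finally show ?thesis .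
    qed
    ultimately have "inverse (real (Suc k)) \<le> measure M (\<Inter>n. G n)"
      by (intro LIMSEQ_le_const) auto
    moreover have "(\<Inter>n. G n) = {}"
    proof (rule ccontr)
      assume "(\<Inter>n. G n) \<noteq> {}"
      then obtain x where "\<forall>n. x \<in> G n" by blast
      then have "\<forall>n. \<exists>i\<ge>n. x \<in> E (f i)"
        unfolding G_def by blast
      then have "infinite {i. x \<in> E (f i)}"
        by (auto simp: infinite_nat_iff_unbounded_le)
      then have "infinite (f ` {i. x \<in> E (f i)})"
        using f(1) by (simp add: finite_image_iff inj_on_subset)
      moreover have "range f \<subseteq> {- real m..real m}"
        using f(2) by (auto simp: A_def subset_iff abs_le_iff minus_le_iff)
      then have "f ` {i. x \<in> E (f i)} \<subseteq> {t \<in> {- real m..real m}. x \<in> E t}"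
        by blast
      ultimately show False
        using fin[of "{- real m..real m}" x] finite_subset by auto
    qed
    ultimately show False by (simp add: not_le)
  qed
  then have "countable (\<Union>m k. A m k)"
    by (intro countable_UN) (auto intro: countable_finite)
  moreover have "{t. emeasure M (E t) \<noteq> 0} \<subseteq> (\<Union>m k. A m k)"
  proof
    fix t assume "t \<in> {t. emeasure M (E t) \<noteq> 0}"
    then have "0 < measure M (E t)"
      by (simp add: emeasure_eq_measure zero_less_measure_iff)
    then obtain k where "inverse (real (Suc k)) < measure M (E t)"
      using reals_Archimedean by blast
    moreover obtain m where "\<bar>t\<bar> \<le> real m" using real_arch_simple by blast
    ultimately show "t \<in> (\<Union>m k. A m k)" by (auto simp: A_def intro: less_imp_le)
  qed
  ultimately show ?thesis using countable_subset by blast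
qed

theorem theorem5p1:
  fixes b :: "complex \<Rightarrow> complex^'n^'n"
    and \<alpha> :: "real \<Rightarrow> complex^'n^'n"
    and \<mu> :: "complex^'n^'n \<Rightarrow> complex set \<Rightarrow> complex^'n^'n"
    and \<nu> :: "complex measure"
  assumes "b \<in> schur_class"
    and "\<And>U. unitary U \<Longrightarrow> clark_measure b U (\<mu> U)"
    and "\<And>t. unitary (\<alpha> t)"
    and "\<alpha> C1_differentiable_on UNIV"
    and "\<And>t. sign_definite (cscale \<i> (vector_derivative \<alpha> (at t) ** matrix_inv (\<alpha> t)))"
    and "circle_radon_measure \<nu>"
    and "mutually_singular \<nu> circle_lebesgue"
  shows "countable {t. \<not> mutually_singular (trace_measure (\<mu> (\<alpha> t))) \<nu>}"
proof -
  have sets: "sets \<nu> = sets circle_borel"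
    using assms(6) by (simp add: circle_radon_measure_def)
  note space = space_circle_measure[OF sets]
  \<comment> \<open>The circle is itself compact, so local finiteness is finiteness.\<close>
  have "finite_measure \<nu>"
    using assms(6) by (intro finite_measureI) (simp add: circle_radon_measure_def space less_top)
  let ?E = "\<lambda>t. resonance_set b (\<alpha> t)"
  have E: "?E t \<in> sets \<nu>" for t
    by (simp add: sets resonance_set_measurable assms(1))
  have D: "(\<alpha> has_vector_derivative vector_derivative \<alpha> (at t)) (at t)" for t
    using assms(4) by (auto simp: C1_differentiable_on_eq vector_derivative_works)
  have "countable {t. emeasure \<nu> (?E t) \<noteq> 0}"
    using finite_resonance_times[OF assms(1,3) D assms(5)]
    by (intro countable_positive_measure \<open>finite_measure \<nu>\<close> E)
  moreover obtain A where A: "A \<in> sets \<nu>" "emeasure \<nu> A = 0"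
    "emeasure circle_lebesgue (sphere 0 1 - A) = 0"
    using assms(7) by (auto simp: mutually_singular_def space_circle_measure)
  have "mutually_singular (trace_measure (\<mu> (\<alpha> t))) \<nu>" if "emeasure \<nu> (?E t) = 0" for t
  proof -
    \<comment> \<open>N is null for arc length and carries \<nu>. The separating set is N without
      the resonance set: the trace measure vanishes on it, and its complement lies in the union of
      two \<nu>-null sets.\<close>
    define N where "N = sphere 0 1 - A"
    have N: "N \<in> sets \<nu>"
      using A(1) sets.compl_sets[of A \<nu>] by (simp add: N_def space)
    have "emeasure (trace_measure (\<mu> (\<alpha> t))) (N - ?E t) = 0"
      using assms(1,2,3) N A(3) by (intro trace_measure_null) (auto simp: sets N_def)
    moreover have "space \<nu> - (N - ?E t) \<subseteq> A \<union> ?E t"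
      by (auto simp: N_def space)
    then have "emeasure \<nu> (space \<nu> - (N - ?E t)) \<le> emeasure \<nu> (A \<union> ?E t)"
      using A(1) E by (intro emeasure_mono) auto
    moreover have "emeasure \<nu> (A \<union> ?E t) = 0"
      using A E that by (simp add: emeasure_Un_null_set null_sets_def)
    ultimately show ?thesis
      using N E[of t] by (auto simp: mutually_singular_def sets intro!: bexI[of _ "N - ?E t"])
  qed
  then have "{t. \<not> mutually_singular (trace_measure (\<mu> (\<alpha> t))) \<nu>} \<subseteq> {t. emeasure \<nu> (?E t) \<noteq> 0}"
    by blast
  ultimately show ?thesis using countable_subset by blast
qed

end
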